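(* Let $n\ge 1$, let $\mathbb{P}^n\subset\mathbb{R}^{n\times n}$ be the set of $n\times n$ permutation matrices, and let $\|\cdot\|$ be an arbitrary entry-wise $p$-norm or an arbitrary operator $p$-norm on $\mathbb{R}^{n\times n}$ ($p\in\{1,2,\dots\}\cup\{\infty\}$). Define $d_{\mathbb{P}^n}:\mathbb{R}^{n\times n}\times\mathbb{R}^{n\times n}\to\mathbb{R}$ by $d_{\mathbb{P}^n}(A,B)=\min_{P\in\mathbb{P}^n}\|AP-PB\|$. Then $d_{\mathbb{P}^n}$ is a pseudometric on $\mathbb{R}^{n\times n}$.
   Context: For $A=[a_{ij}]\in\mathbb{R}^{n\times n}$, the entry-wise $p$-norm is $\|A\|_p=(\sum_{i,j}|a_{ij}|^p)^{1/p}$ for finite $p$ and $\|A\|_\infty=\max_{i,j}|a_{ij}|$; the operator $p$-norm is $\|A\|_p=\sup_{x\in\mathbb{R}^n,\|x\|_p=1}\|Ax\|_p$ with $\|\cdot\|_p$ the vector $p$-norm. A pseudometric on a set $\Omega$ is a function $d:\Omega\times\Omega\to\mathbb{R}$ such that for all $x,y,z\in\Omega$: $d(x,y)\ge 0$, $d(x,x)=0$, $d(x,y)=d(y,x)$, and $d(x,y)\le d(x,z)+d(z,y)$. *)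

theory Defs
  imports "HOL-Analysis.Analysis" "HOL-Library.Extended_Nat"
begin

text \<open>
  The exponent ranges over \<open>enat\<close>, with \<open>\<infinity>\<close> giving the maximum norms. The three
  functions below are norms for \<open>1 \<le> p\<close>; their value at \<open>p = 0\<close> is meaningless.
\<close>

definition vec_pnorm :: "enat \<Rightarrow> real ^ 'n \<Rightarrow> real" where
  "vec_pnorm p x =
    (case p of
      enat k \<Rightarrow> (\<Sum>i\<in>UNIV. \<bar>x $ i\<bar> ^ k) powr (1 / real k)
    | \<infinity> \<Rightarrow> Max (range (\<lambda>i. \<bar>x $ i\<bar>)))"

definition entrywise_pnorm :: "enat \<Rightarrow> real ^ 'n ^ 'n \<Rightarrow> real" where
  "entrywise_pnorm p A =
    (case p of
      enat k \<Rightarrow> (\<Sum>i\<in>UNIV. \<Sum>j\<in>UNIV. \<bar>A $ i $ j\<bar> ^ k) powr (1 / real k)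
    | \<infinity> \<Rightarrow> Max (range (\<lambda>(i, j). \<bar>A $ i $ j\<bar>)))"

definition operator_pnorm :: "enat \<Rightarrow> real ^ 'n ^ 'n \<Rightarrow> real" where
  "operator_pnorm p A = (SUP x \<in> {x. vec_pnorm p x = 1}. vec_pnorm p (A *v x))"

definition permutation_matrices :: "(real ^ 'n ^ 'n) set" where
  "permutation_matrices =
    {P. (\<forall>i j. P $ i $ j \<in> {0, 1}) \<and>
        (\<forall>i. \<exists>!j. P $ i $ j = 1) \<and>
        (\<forall>j. \<exists>!i. P $ i $ j = 1)}"

definition perm_dist ::
  "(real ^ 'n ^ 'n \<Rightarrow> real) \<Rightarrow> real ^ 'n ^ 'n \<Rightarrow> real ^ 'n ^ 'n \<Rightarrow> real" where
  "perm_dist N A B = Min ((\<lambda>P. N (A ** P - P ** B)) ` permutation_matrices)"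

definition pseudometric_on :: "'a set \<Rightarrow> ('a \<Rightarrow> 'a \<Rightarrow> real) \<Rightarrow> bool" where
  "pseudometric_on \<Omega> d \<longleftrightarrow>
    (\<forall>x\<in>\<Omega>. \<forall>y\<in>\<Omega>. \<forall>z\<in>\<Omega>.
      0 \<le> d x y \<and> d x x = 0 \<and> d x y = d y x \<and> d x y \<le> d x z + d z y)"

end

theory Submission
  imports Defs
begin

text \<open>
  Each of the norms satisfies the triangle inequality (Minkowski) and is invariant under
  multiplication by a permutation matrix on either side. Symmetry of the distance follows from
  \<open>B P\<^sup>T - P\<^sup>T A = - P\<^sup>T (A P - P B) P\<^sup>T\<close>, and the triangle inequality from
  \<open>A (P Q) - (P Q) B = (A P - P C) Q + P (C Q - Q B)\<close>.
\<close>

section \<open>The p-norm of a finite family\<close>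

text \<open>Indexing by an arbitrary finite type lets one set of lemmas serve both vectors and, over
  index pairs, the entries of a matrix.\<close>

definition pnorm :: "enat \<Rightarrow> ('i::finite \<Rightarrow> real) \<Rightarrow> real" where
  "pnorm p f =
    (case p of
      enat k \<Rightarrow> (\<Sum>i\<in>UNIV. \<bar>f i\<bar> ^ k) powr (1 / real k)
    | \<infinity> \<Rightarrow> Max (range (\<lambda>i. \<bar>f i\<bar>)))"

lemma vec_pnorm_eq_pnorm: "vec_pnorm p x = pnorm p (\<lambda>i. x $ i)"
  by (simp add: vec_pnorm_def pnorm_def)

lemma entrywise_pnorm_eq_pnorm: "entrywise_pnorm p A = pnorm p (\<lambda>(i, j). A $ i $ j)"
  by (simp add: entrywise_pnorm_def pnorm_def sum.cartesian_product case_prod_unfold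
      flip: UNIV_Times_UNIV split: enat.split)

lemma pnorm_nonneg: "0 \<le> pnorm p f"
proof (cases p)
  case infinity
  have "0 \<le> \<bar>f undefined\<bar>" by simp
  also have "\<dots> \<le> Max (range (\<lambda>i. \<bar>f i\<bar>))" by (rule Max_ge) auto
  finally show ?thesis by (simp add: infinity pnorm_def)
qed (simp add: pnorm_def)

text \<open>Removes the root, so that finite exponents can be handled with natural powers and finite
  sums instead of \<open>powr\<close>.\<close>

lemma pnorm_enat_power:
  assumes "1 \<le> k"
  shows "pnorm (enat k) f ^ k = (\<Sum>i\<in>UNIV. \<bar>f i\<bar> ^ k)"
proof -
  have "0 \<le> (\<Sum>i\<in>UNIV. \<bar>f i\<bar> ^ k)" by (simp add: sum_nonneg)
  then show ?thesis
    \<comment> \<open>\<open>powr_realpow\<close> requires a positive base, so a vanishing sum is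
      treated apart.\<close>
    using assms by (cases "(\<Sum>i\<in>UNIV. \<bar>f i\<bar> ^ k) = 0")
      (auto simp: pnorm_def powr_powr simp flip: powr_realpow)
qed

lemma pnorm_enat_le_iff:
  assumes "1 \<le> k" "0 \<le> c"
  shows "pnorm (enat k) f \<le> c \<longleftrightarrow> (\<Sum>i\<in>UNIV. \<bar>f i\<bar> ^ k) \<le> c ^ k"
  using assms by (simp add: pnorm_nonneg flip: pnorm_enat_power)

lemma pnorm_infinity_le_iff: "pnorm \<infinity> f \<le> c \<longleftrightarrow> (\<forall>i. \<bar>f i\<bar> \<le> c)"
  by (simp add: pnorm_def)

lemma pnorm_mono:
  assumes "1 \<le> p" "\<And>i. \<bar>f i\<bar> \<le> \<bar>g i\<bar>"
  shows "pnorm p f \<le> pnorm p g"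
proof (cases p)
  case (enat k)
  then have "1 \<le> k" using assms by (simp add: one_enat_def)
  then show ?thesis
    using assms(2) by (simp add: enat pnorm_enat_le_iff pnorm_nonneg pnorm_enat_power sum_mono power_mono)
next
  case infinity
  have "\<bar>g i\<bar> \<le> pnorm \<infinity> g" for i
    using pnorm_infinity_le_iff[of g "pnorm \<infinity> g"] by simp
  then show ?thesis
    using assms(2) by (auto simp: infinity pnorm_infinity_le_iff intro: order_trans)
qed

text \<open>Serves twice: a family of norm zero vanishes, and the coordinates of a unit vector are
  at most 1 in absolute value.\<close>

lemma abs_le_pnorm:
  assumes "1 \<le> p"
  shows "\<bar>f i\<bar> \<le> pnorm p f"
proof (cases p)
  case (enat k)
  then have k: "1 \<le> k" using assms by (simp add: one_enat_def)
  have "\<bar>f i\<bar> ^ k \<le> (\<Sum>i\<in>UNIV. \<bar>f i\<bar> ^ k)"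
    by (rule member_le_sum) auto
  then show ?thesis
    using k pnorm_nonneg[of p f] by (simp add: enat flip: pnorm_enat_power)
next
  case infinity
  then show ?thesis using pnorm_infinity_le_iff[of f "pnorm \<infinity> f"] by simp
qed

lemma pnorm_zero:
  assumes "1 \<le> p"
  shows "pnorm p (\<lambda>i. 0) = 0"
  using assms by (cases p) (auto simp: pnorm_def one_enat_def zero_power)

lemma pnorm_uminus: "pnorm p (\<lambda>i. - f i) = pnorm p f"
  unfolding pnorm_def abs_minus_cancel ..

text \<open>The source of all permutation invariance below: multiplying by a permutation matrix
  merely rearranges entries.\<close>

lemma pnorm_reindex:
  assumes "bij \<sigma>"
  shows "pnorm p (\<lambda>i. f (\<sigma> i)) = pnorm p f"
proof -
  have "(\<Sum>i\<in>UNIV. \<bar>f (\<sigma> i)\<bar> ^ k) = (\<Sum>i\<in>UNIV. \<bar>f i\<bar> ^ k)" for k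
    using assms by (intro sum.reindex_bij_betw) simp
  moreover have "range (\<lambda>i. \<bar>f (\<sigma> i)\<bar>) = range (\<lambda>i. \<bar>f i\<bar>)"
    using bij_is_surj[OF assms] by (metis (no_types) image_image)
  ultimately show ?thesis by (simp add: pnorm_def split: enat.split)
qed

text \<open>The half-line is the right domain because odd powers above the first are not convex on
  the whole line; the lemma is applied to absolute values.\<close>

lemma convex_power_nonneg: "convex_on {0::real..} (\<lambda>x. x ^ n)"
  by (cases "even n") (auto intro: convex_power_odd convex_on_subset[OF convex_power_even])

text \<open>
  Writing \<open>f = a u\<close> and \<open>g = b v\<close> with \<open>u\<close>, \<open>v\<close> of norm one, \<open>(f + g) / (a + b)\<close> is a convex
  combination of \<open>u\<close> and \<open>v\<close>, so the claim follows from convexity of \<open>x \<mapsto> x ^ k\<close>.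
\<close>
lemma pnorm_triangle:
  assumes p: "1 \<le> p"
  shows "pnorm p (\<lambda>i. f i + g i) \<le> pnorm p f + pnorm p g"
proof (cases p)
  case infinity
  have "\<bar>f i + g i\<bar> \<le> pnorm p f + pnorm p g" for i
    using abs_le_pnorm[OF p, of f i] abs_le_pnorm[OF p, of g i] by linarith
  then show ?thesis by (simp add: infinity pnorm_infinity_le_iff)
next
  case (enat k)
  then have k: "1 \<le> k" using p by (simp add: one_enat_def)
  define a b where "a = pnorm p f" and "b = pnorm p g"
  have ab: "0 \<le> a" "0 \<le> b" by (simp_all add: a_def b_def pnorm_nonneg)
  \<comment> \<open>Normalising divides by \<open>a\<close> and \<open>b\<close>; if one of them is
    zero, that family is zero and the inequality is immediate.\<close>
  consider "a = 0" | "b = 0" | "a > 0" "b > 0" using ab by linarith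
  then show ?thesis
  proof cases
    case 1
    then have "f i = 0" for i using abs_le_pnorm[OF p, of f i] by (simp add: a_def)
    then show ?thesis by (simp add: pnorm_nonneg)
  next
    case 2
    then have "g i = 0" for i using abs_le_pnorm[OF p, of g i] by (simp add: b_def)
    then show ?thesis by (simp add: pnorm_nonneg)
  next
    case 3
    define t where "t = b / (a + b)"
    have t: "0 \<le> t" "t \<le> 1" "1 - t = a / (a + b)" using 3 by (auto simp: t_def field_simps)
    have "\<bar>f i + g i\<bar> ^ k
        \<le> (a + b) ^ k * ((1 - t) * (\<bar>f i\<bar> ^ k / a ^ k) + t * (\<bar>g i\<bar> ^ k / b ^ k))" for i
    proof -
      have "\<bar>f i\<bar> + \<bar>g i\<bar> = (a + b) * ((1 - t) * (\<bar>f i\<bar> / a) + t * (\<bar>g i\<bar> / b))"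
        unfolding t(3) unfolding t_def using 3 by (simp add: distrib_left)
      then have "(\<bar>f i\<bar> + \<bar>g i\<bar>) ^ k
          = (a + b) ^ k * ((1 - t) * (\<bar>f i\<bar> / a) + t * (\<bar>g i\<bar> / b)) ^ k"
        by (simp add: power_mult_distrib)
      also have "\<dots> \<le> (a + b) ^ k * ((1 - t) * (\<bar>f i\<bar> / a) ^ k + t * (\<bar>g i\<bar> / b) ^ k)"
        using convex_onD[OF convex_power_nonneg t(1,2), of "\<bar>f i\<bar> / a" "\<bar>g i\<bar> / b" k] 3
        by (intro mult_left_mono) auto
      finally have "(\<bar>f i\<bar> + \<bar>g i\<bar>) ^ k
          \<le> (a + b) ^ k * ((1 - t) * (\<bar>f i\<bar> ^ k / a ^ k) + t * (\<bar>g i\<bar> ^ k / b ^ k))"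
        by (simp add: power_divide)
      moreover have "\<bar>f i + g i\<bar> ^ k \<le> (\<bar>f i\<bar> + \<bar>g i\<bar>) ^ k"
        by (intro power_mono) auto
      ultimately show ?thesis by linarith
    qed
    then have "(\<Sum>i\<in>UNIV. \<bar>f i + g i\<bar> ^ k) \<le>
        (\<Sum>i\<in>UNIV. (a + b) ^ k * ((1 - t) * (\<bar>f i\<bar> ^ k / a ^ k) + t * (\<bar>g i\<bar> ^ k / b ^ k)))"
      by (rule sum_mono)
    also have "\<dots> = (a + b) ^ k *
        ((1 - t) * ((\<Sum>i\<in>UNIV. \<bar>f i\<bar> ^ k) / a ^ k) + t * ((\<Sum>i\<in>UNIV. \<bar>g i\<bar> ^ k) / b ^ k))"
      by (simp only: sum.distrib sum_distrib_left[symmetric] sum_divide_distrib[symmetric])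
    \<comment> \<open>The two sums are \<open>a ^ k\<close> and \<open>b ^ k\<close>, so the bracket
      collapses to \<open>(1 - t) + t\<close>.\<close>
    also have "\<dots> = (a + b) ^ k"
      using 3 k by (simp add: a_def b_def enat pnorm_enat_power[symmetric])
    finally show ?thesis
      using 3 k by (simp add: enat pnorm_enat_le_iff a_def b_def)
  qed
qed

section \<open>Permutation matrices\<close>

text \<open>Turns the 0/1 description into a bijection sending each row to the column of its single
  1, the form in which products are computed.\<close>

lemma permutation_matrixE:
  assumes "P \<in> permutation_matrices"
  obtains \<sigma> where "bij \<sigma>" "\<And>i j. P $ i $ j = (if j = \<sigma> i then 1 else 0)"
proof -
  have 01: "P $ i $ j = 0 \<or> P $ i $ j = 1" and row: "\<exists>!j. P $ i $ j = 1"
    and col: "\<exists>!i. P $ i $ j = 1" for i j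
    using assms by (auto simp: permutation_matrices_def)
  define \<sigma> where "\<sigma> i = (THE j. P $ i $ j = 1)" for i
  have \<sigma>: "P $ i $ j = 1 \<longleftrightarrow> j = \<sigma> i" for i j
    using theI'[OF row] row unfolding \<sigma>_def by metis
  have "bij \<sigma>"
    unfolding bij_iff using col by (simp add: \<sigma>) metis
  moreover have "P $ i $ j = (if j = \<sigma> i then 1 else 0)" for i j
    using \<sigma> 01 by auto
  ultimately show ?thesis by (rule that)
qed

lemma permutation_matrixI:
  assumes "bij \<sigma>" "\<And>i j. P $ i $ j = (if j = \<sigma> i then 1 else 0)"
  shows "P \<in> permutation_matrices"
  using assms by (auto simp: permutation_matrices_def bij_iff) metis+

lemma mat_1_permutation_matrix: "mat 1 \<in> permutation_matrices"
  by (rule permutation_matrixI[of id]) (auto simp: mat_def)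

text \<open>Such a matrix is determined by a self-map of a finite type. Finiteness is what makes the
  \<open>Min\<close> in \<open>perm_dist\<close> a genuine minimum.\<close>

lemma finite_permutation_matrices: "finite permutation_matrices"
proof (rule finite_subset)
  show "permutation_matrices \<subseteq> range (\<lambda>\<sigma>. \<chi> i j. if j = \<sigma> i then 1 else 0)"
    by (auto elim!: permutation_matrixE simp: image_iff vec_eq_iff)
qed simp

lemma permutation_matrix_mult_left:
  fixes A :: "real ^ 'm ^ 'n"
  assumes "\<And>i j. P $ i $ j = (if j = \<sigma> i then 1 else 0)"
  shows "(P ** A) $ i $ j = A $ \<sigma> i $ j"
  by (simp add: matrix_matrix_mult_def assms if_distrib[of "\<lambda>x. x * _"] cong: if_cong)

lemma permutation_matrix_mult_vec:
  fixes x :: "real ^ 'n"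
  assumes "\<And>i j. P $ i $ j = (if j = \<sigma> i then 1 else 0)"
  shows "(P *v x) $ i = x $ \<sigma> i"
  by (simp add: matrix_vector_mult_def assms if_distrib[of "\<lambda>x. x * _"] cong: if_cong)

lemma permutation_matrix_mult:
  assumes "P \<in> permutation_matrices" "Q \<in> permutation_matrices"
  shows "P ** Q \<in> permutation_matrices"
proof -
  from assms(1) obtain \<sigma> where \<sigma>: "bij \<sigma>" "\<And>i j. P $ i $ j = (if j = \<sigma> i then 1 else 0)"
    by (rule permutation_matrixE) (rule that)
  from assms(2) obtain \<tau> where \<tau>: "bij \<tau>" "\<And>i j. Q $ i $ j = (if j = \<tau> i then 1 else 0)"
    by (rule permutation_matrixE) (rule that)
  show ?thesis
    \<comment> \<open>Row \<open>i\<close> of \<open>P ** Q\<close> is row \<open>\<sigma> i\<close>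
      of \<open>Q\<close>, which explains the order of composition.\<close>
    by (rule permutation_matrixI[of "\<tau> \<circ> \<sigma>"])
      (use \<sigma> \<tau> in \<open>auto simp: bij_comp permutation_matrix_mult_left[OF \<sigma>(2)]\<close>)
qed

lemma transpose_permutation_matrix:
  assumes "P \<in> permutation_matrices"
  shows "transpose P \<in> permutation_matrices"
  using assms by (simp add: permutation_matrices_def transpose_def)

lemma permutation_matrix_transpose_right:
  assumes "P \<in> permutation_matrices"
  shows "P ** transpose P = mat 1"
proof -
  from assms obtain \<sigma> where \<sigma>: "bij \<sigma>" "\<And>i j. P $ i $ j = (if j = \<sigma> i then 1 else 0)"
    by (rule permutation_matrixE) (rule that)
  show ?thesis
    using bij_is_inj[OF \<sigma>(1)]
    by (auto simp: vec_eq_iff permutation_matrix_mult_left[OF \<sigma>(2)] transpose_def mat_def \<sigma>(2)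
        dest: injD)
qed

lemma permutation_matrix_transpose_left:
  assumes "P \<in> permutation_matrices"
  shows "transpose P ** P = mat 1"
  using permutation_matrix_transpose_right[OF transpose_permutation_matrix[OF assms]] by simp

lemma vec_pnorm_permutation_matrix:
  assumes "P \<in> permutation_matrices"
  shows "vec_pnorm p (P *v x) = vec_pnorm p x"
proof -
  from assms obtain \<sigma> where \<sigma>: "bij \<sigma>" "\<And>i j. P $ i $ j = (if j = \<sigma> i then 1 else 0)"
    by (rule permutation_matrixE) (rule that)
  show ?thesis
    by (simp add: vec_pnorm_eq_pnorm permutation_matrix_mult_vec[OF \<sigma>(2)] pnorm_reindex[OF \<sigma>(1)])
qed

section \<open>Permutation-invariant norms\<close>

lemma matrix_diff_ldistrib:
  fixes A :: "'a::ring_1 ^ 'n ^ 'm"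
  shows "A ** (B - C) = A ** B - A ** C"
  by (simp add: matrix_matrix_mult_def vec_eq_iff right_diff_distrib sum_subtractf)

lemma matrix_diff_rdistrib:
  fixes A B :: "'a::ring_1 ^ 'n ^ 'm"
  shows "(A - B) ** C = A ** C - B ** C"
  by (simp add: matrix_matrix_mult_def vec_eq_iff left_diff_distrib sum_subtractf)

text \<open>A common interface to the entry-wise and operator norms, so that the pseudometric
  argument is carried out once. Homogeneity enters through the values at zero and under a change of
  sign.\<close>

locale perm_invariant_seminorm =
  fixes N :: "real ^ 'n ^ 'n \<Rightarrow> real"
  assumes nonneg: "0 \<le> N A"
    and zero: "N 0 = 0"
    and uminus: "N (- A) = N A"
    and triangle: "N (A + B) \<le> N A + N B"
    and mult_left: "P \<in> permutation_matrices \<Longrightarrow> N (P ** A) = N A"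
    and mult_right: "P \<in> permutation_matrices \<Longrightarrow> N (A ** P) = N A"
begin

lemma perm_dist_le:
  assumes "P \<in> permutation_matrices"
  shows "perm_dist N A B \<le> N (A ** P - P ** B)"
  unfolding perm_dist_def using assms finite_permutation_matrices by (intro Min_le) auto

text \<open>The minimum runs over a finite set that contains the identity, so a minimiser exists;
  symmetry and the triangle inequality start from one.\<close>

lemma perm_dist_attained:
  obtains P where "P \<in> permutation_matrices" "perm_dist N A B = N (A ** P - P ** B)"
proof -
  have "perm_dist N A B \<in> (\<lambda>P. N (A ** P - P ** B)) ` permutation_matrices"
    unfolding perm_dist_def using finite_permutation_matrices mat_1_permutation_matrix
    by (intro Min_in) auto
  then show ?thesis using that by auto
qed

lemma perm_dist_nonneg: "0 \<le> perm_dist N A B"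
  by (metis perm_dist_attained nonneg)

lemma perm_dist_self: "perm_dist N A A = 0"
  using perm_dist_le[OF mat_1_permutation_matrix, of A A] perm_dist_nonneg[of A A]
  by (simp add: zero)

text \<open>One inequality suffices: exchanging \<open>A\<close> and \<open>B\<close> gives the
  other, and antisymmetry yields equality.\<close>

lemma perm_dist_sym_le: "perm_dist N B A \<le> perm_dist N A B"
proof -
  obtain P where P: "P \<in> permutation_matrices" "perm_dist N A B = N (A ** P - P ** B)"
    by (rule perm_dist_attained)
  let ?Q = "transpose P"
  have Q: "?Q \<in> permutation_matrices" by (rule transpose_permutation_matrix[OF P(1)])
  have "?Q ** (A ** P - P ** B) ** ?Q = ?Q ** A ** (P ** ?Q) - (?Q ** P) ** B ** ?Q"
    by (simp add: matrix_diff_ldistrib matrix_diff_rdistrib matrix_mul_assoc)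
  also have "\<dots> = - (B ** ?Q - ?Q ** A)"
    by (simp add: permutation_matrix_transpose_right[OF P(1)]
        permutation_matrix_transpose_left[OF P(1)])
  finally have "N (B ** ?Q - ?Q ** A) = N (A ** P - P ** B)"
    by (metis uminus mult_left mult_right Q)
  then show ?thesis
    using perm_dist_le[OF Q, of B A] P(2) by simp
qed

lemma perm_dist_triangle: "perm_dist N A B \<le> perm_dist N A C + perm_dist N C B"
proof -
  obtain P where P: "P \<in> permutation_matrices" "perm_dist N A C = N (A ** P - P ** C)"
    by (rule perm_dist_attained)
  obtain Q where Q: "Q \<in> permutation_matrices" "perm_dist N C B = N (C ** Q - Q ** B)"
    by (rule perm_dist_attained)
  have "A ** (P ** Q) - (P ** Q) ** B = (A ** P - P ** C) ** Q + P ** (C ** Q - Q ** B)"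
    by (simp add: matrix_diff_ldistrib matrix_diff_rdistrib matrix_mul_assoc)
  then have "N (A ** (P ** Q) - (P ** Q) ** B) \<le> N (A ** P - P ** C) + N (C ** Q - Q ** B)"
    using triangle[of "(A ** P - P ** C) ** Q" "P ** (C ** Q - Q ** B)"]
    by (simp add: mult_left[OF P(1)] mult_right[OF Q(1)])
  then show ?thesis
    using perm_dist_le[OF permutation_matrix_mult[OF P(1) Q(1)], of A B] P(2) Q(2) by simp
qed

theorem pseudometric_on_perm_dist: "pseudometric_on UNIV (perm_dist N)"
  unfolding pseudometric_on_def
  by (auto simp: perm_dist_nonneg perm_dist_self perm_dist_triangle
      intro: antisym perm_dist_sym_le)

end

section \<open>The entry-wise p-norm\<close>

lemma perm_invariant_seminorm_entrywise_pnorm: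
  assumes p: "1 \<le> p"
  shows "perm_invariant_seminorm (entrywise_pnorm p :: real ^ 'n ^ 'n \<Rightarrow> real)"
proof
  fix A B P :: "real ^ 'n ^ 'n"
  show "0 \<le> entrywise_pnorm p A"
    by (simp add: entrywise_pnorm_eq_pnorm pnorm_nonneg)
  show "entrywise_pnorm p (0 :: real ^ 'n ^ 'n) = 0"
    using pnorm_zero[OF p, where 'a = "'n \<times> 'n"]
    by (simp add: entrywise_pnorm_eq_pnorm case_prod_unfold)
  show "entrywise_pnorm p (- A) = entrywise_pnorm p A"
    using pnorm_uminus[of p "\<lambda>(i, j). A $ i $ j"]
    by (simp add: entrywise_pnorm_eq_pnorm case_prod_unfold)
  show "entrywise_pnorm p (A + B) \<le> entrywise_pnorm p A + entrywise_pnorm p B"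
    using pnorm_triangle[OF p, of "\<lambda>(i, j). A $ i $ j" "\<lambda>(i, j). B $ i $ j"]
    by (simp add: entrywise_pnorm_eq_pnorm case_prod_unfold)
  \<comment> \<open>Stated for all matrices because right invariance will apply it to
    \<open>transpose P\<close> and \<open>transpose A\<close>.\<close>
  have left: "entrywise_pnorm p (P ** A) = entrywise_pnorm p A"
    if "P \<in> permutation_matrices" for P A :: "real ^ 'n ^ 'n"
  proof -
    from that obtain \<sigma> where \<sigma>: "bij \<sigma>" "\<And>i j. P $ i $ j = (if j = \<sigma> i then 1 else 0)"
      by (rule permutation_matrixE) (rule that)
    \<comment> \<open>Left multiplication permutes the row index and fixes the column index.\<close>
    have "bij (map_prod \<sigma> (id :: 'n \<Rightarrow> 'n))"
      using \<sigma>(1) by (metis bij_betw_map_prod bij_id UNIV_Times_UNIV)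
    from pnorm_reindex[OF this, of p "\<lambda>(i, j). A $ i $ j"] show ?thesis
      by (simp add: entrywise_pnorm_eq_pnorm permutation_matrix_mult_left[OF \<sigma>(2)]
          case_prod_unfold)
  qed
  have transpose: "entrywise_pnorm p (transpose A) = entrywise_pnorm p A" for A :: "real ^ 'n ^ 'n"
    using pnorm_reindex[OF bij_swap, of p "\<lambda>(i, j). A $ i $ j"]
    by (simp add: entrywise_pnorm_eq_pnorm transpose_def case_prod_unfold)
  assume P: "P \<in> permutation_matrices"
  then show "entrywise_pnorm p (P ** A) = entrywise_pnorm p A" by (rule left)
  \<comment> \<open>Transposition swaps the index pair and so keeps the norm, which reduces right
    multiplication to left multiplication.\<close>
  have "entrywise_pnorm p (A ** P) = entrywise_pnorm p (transpose P ** transpose A)"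
    by (metis transpose matrix_transpose_mul)
  then show "entrywise_pnorm p (A ** P) = entrywise_pnorm p A"
    by (simp add: left[OF transpose_permutation_matrix[OF P]] transpose)
qed

section \<open>The operator p-norm\<close>

text \<open>Supplies a point of the unit sphere, so that the supremum in the operator norm is over a
  nonempty set.\<close>

lemma vec_pnorm_axis:
  assumes "1 \<le> p"
  shows "vec_pnorm p (axis i 1) = 1"
proof (cases p)
  case (enat k)
  then have "1 \<le> k" using assms by (simp add: one_enat_def)
  then have "\<bar>axis i 1 $ j\<bar> ^ k = (if j = i then 1 else 0 :: real)" for j
    by (simp add: axis_def)
  then show ?thesis by (simp add: vec_pnorm_def enat)
next
  case infinity
  have "Max (range (\<lambda>j. \<bar>axis i 1 $ j :: real\<bar>)) = 1"
    by (rule Max_eqI) (auto simp: axis_def image_iff)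
  then show ?thesis by (simp add: vec_pnorm_def infinity)
qed

lemma vec_pnorm_sphere_nonempty:
  assumes "1 \<le> p"
  shows "{x :: real ^ 'n. vec_pnorm p x = 1} \<noteq> {}"
  using vec_pnorm_axis[OF assms] by blast

text \<open>A real supremum can be used as an upper bound only over a bounded set. A crude bound is
  enough: coordinates of a unit vector are at most 1 in absolute value, so each coordinate of
  \<open>A *v x\<close> is bounded by an absolute row sum of \<open>A\<close>.\<close>

lemma bdd_above_operator_pnorm:
  fixes A :: "real ^ 'n ^ 'n"
  assumes p: "1 \<le> p"
  shows "bdd_above ((\<lambda>x. vec_pnorm p (A *v x)) ` {x. vec_pnorm p x = 1})"
proof (rule bdd_aboveI2)
  fix x :: "real ^ 'n"
  assume "x \<in> {x. vec_pnorm p x = 1}"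
  then have x: "\<bar>x $ j\<bar> \<le> 1" for j
    using abs_le_pnorm[OF p, of "\<lambda>i. x $ i" j] by (simp add: vec_pnorm_eq_pnorm)
  have "\<bar>(A *v x) $ i\<bar> \<le> (\<Sum>j\<in>UNIV. \<bar>A $ i $ j\<bar>)" for i
  proof -
    have "\<bar>(A *v x) $ i\<bar> \<le> (\<Sum>j\<in>UNIV. \<bar>A $ i $ j * x $ j\<bar>)"
      unfolding matrix_vector_mult_def by (simp add: sum_abs)
    also have "\<dots> \<le> (\<Sum>j\<in>UNIV. \<bar>A $ i $ j\<bar>)"
      using x by (intro sum_mono) (simp add: abs_mult mult_left_le)
    finally show ?thesis .
  qed
  then show "vec_pnorm p (A *v x) \<le> pnorm p (\<lambda>i. \<Sum>j\<in>UNIV. \<bar>A $ i $ j\<bar>)"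
    unfolding vec_pnorm_eq_pnorm
    by (intro pnorm_mono[OF p]) (meson abs_ge_self order_trans)
qed

lemma perm_invariant_seminorm_operator_pnorm:
  assumes p: "1 \<le> p"
  shows "perm_invariant_seminorm (operator_pnorm p :: real ^ 'n ^ 'n \<Rightarrow> real)"
proof
  fix A B P :: "real ^ 'n ^ 'n"
  let ?S = "{x :: real ^ 'n. vec_pnorm p x = 1}"
  have le: "vec_pnorm p (A *v x) \<le> operator_pnorm p A" if "vec_pnorm p x = 1" for A and x :: "real ^ 'n"
    unfolding operator_pnorm_def using that by (intro cSUP_upper bdd_above_operator_pnorm[OF p]) simp
  obtain x0 :: "real ^ 'n" where "vec_pnorm p x0 = 1"
    using vec_pnorm_sphere_nonempty[OF p] by blast
  with le show "0 \<le> operator_pnorm p A"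
    by (metis order_trans pnorm_nonneg vec_pnorm_eq_pnorm)
  have "vec_pnorm p (0 :: real ^ 'n) = 0"
    by (simp add: vec_pnorm_eq_pnorm pnorm_zero[OF p])
  then show "operator_pnorm p (0 :: real ^ 'n ^ 'n) = 0"
    by (simp add: operator_pnorm_def cSUP_const[OF vec_pnorm_sphere_nonempty[OF p]])
  have "vec_pnorm p (- A *v x) = vec_pnorm p (A *v x)" for x
    using pnorm_uminus[of p "\<lambda>i. (A *v x) $ i"]
    by (simp add: vec_pnorm_eq_pnorm matrix_vector_mult_def sum_negf)
  then show "operator_pnorm p (- A) = operator_pnorm p A"
    by (simp add: operator_pnorm_def)
  show "operator_pnorm p (A + B) \<le> operator_pnorm p A + operator_pnorm p B"
    unfolding operator_pnorm_def[of p "A + B"]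
  proof (rule cSUP_least[OF vec_pnorm_sphere_nonempty[OF p]])
    fix x assume "x \<in> ?S"
    then have "vec_pnorm p (A *v x) + vec_pnorm p (B *v x) \<le> operator_pnorm p A + operator_pnorm p B"
      by (intro add_mono le) auto
    moreover have "vec_pnorm p ((A + B) *v x) \<le> vec_pnorm p (A *v x) + vec_pnorm p (B *v x)"
      using pnorm_triangle[OF p, of "\<lambda>i. (A *v x) $ i" "\<lambda>i. (B *v x) $ i"]
      by (simp add: vec_pnorm_eq_pnorm matrix_vector_mult_add_rdistrib)
    ultimately show "vec_pnorm p ((A + B) *v x) \<le> operator_pnorm p A + operator_pnorm p B"
      by linarith
  qed
  assume P: "P \<in> permutation_matrices"
  \<comment> \<open>Here \<open>P\<close> acts on the output vector and preserves its norm, so no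
    value under the supremum changes.\<close>
  show "operator_pnorm p (P ** A) = operator_pnorm p A"
    by (simp add: operator_pnorm_def vec_pnorm_permutation_matrix[OF P]
        flip: matrix_vector_mul_assoc)
  \<comment> \<open>On the right, \<open>P\<close> acts on the argument instead: it maps the unit
    sphere onto itself, with \<open>transpose P *v x\<close> as the preimage of \<open>x\<close>, so
    the supremum is over the same set of values.\<close>
  have "(*v) P ` ?S = ?S"
  proof (intro equalityI subsetI)
    fix x assume "x \<in> ?S"
    moreover have "x = P *v (transpose P *v x)"
      by (simp only: matrix_vector_mul_assoc permutation_matrix_transpose_right[OF P]
          matrix_vector_mul_lid)
    moreover have "vec_pnorm p (transpose P *v x) = vec_pnorm p x"
      by (rule vec_pnorm_permutation_matrix[OF transpose_permutation_matrix[OF P]])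
    ultimately show "x \<in> (*v) P ` ?S" by (metis (mono_tags) image_eqI mem_Collect_eq)
  qed (auto simp: vec_pnorm_permutation_matrix[OF P])
  then have "(\<lambda>x. vec_pnorm p (A *v x)) ` ?S = (\<lambda>x. vec_pnorm p (A *v (P *v x))) ` ?S"
    by (metis (no_types) image_image)
  then show "operator_pnorm p (A ** P) = operator_pnorm p A"
    by (simp add: operator_pnorm_def flip: matrix_vector_mul_assoc)
qed

theorem theorem1:
  fixes N :: "real ^ 'n ^ 'n \<Rightarrow> real" and p :: enat
  assumes "1 \<le> p"
    and "N = entrywise_pnorm p \<or> N = operator_pnorm p"
  shows "pseudometric_on (UNIV :: (real ^ 'n ^ 'n) set) (perm_dist N)"
  using assms perm_invariant_seminorm.pseudometric_on_perm_dist
    perm_invariant_seminorm_entrywise_pnorm perm_invariant_seminorm_operator_pnorm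
  by blast

end
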